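(* Let $h$, $m$ and $s$ be positive integers with $s \leq m$. Let $G$ be an additive abelian group with $p(G) \geq 3$. Then $$\rho_{\pm}^{(s)} (G, m, [0, h]) = \begin{cases} \rho_{\pm}^{(s)} (G, m, h), & \text{if } s \equiv 1 \pmod{2};\\ \rho_{\pm}^{(s + 1)} (G, m + 1, h), & \text{if } s \equiv 0 \pmod{2}. \end{cases}$$
   Context: For a nonempty finite subset $A=\{a_1,\dots,a_k\}$ (with $|A|=k$) of an additive abelian group $G$ and a nonnegative integer $h$, the $h$-fold signed sumset is $h_{\pm}A=\{\sum_{i=1}^k\lambda_i a_i:\lambda_i\in\mathbb{Z}\cap[-h,h],\ \sum_{i=1}^k|\lambda_i|=h\}$, with $0_{\pm}A=\{0\}$. For a finite nonempty set $H$ of nonnegative integers, $H_{\pm}A=\bigcup_{h\in H}h_{\pm}A$; $[0,h]$ denotes the set of integers $\{0,1,\dots,h\}$. Write $-A=\{-a:a\in A\}$. Define $$\rho_{\pm}^{(s)}(G,m,H)=\min\{|H_{\pm}A|:A\subseteq G,\ |A|=m,\ |A\cap(-A)|=s\},$$ and $\rho_{\pm}^{(s)}(G,m,h)=\rho_{\pm}^{(s)}(G,m,\{h\})$. Minima are understood to be over nonempty families, i.e. the parameters are such that at least one such set exists. The group $G$ need not be finite. $p(G)$ denotes the order of the smallest nontrivial subgroup of $G$, or $\infty$ if no such (finite) subgroup exists. *)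

theory Defs
  imports "HOL-Algebra.Algebra" "HOL-Library.Extended_Nat"
begin

text \<open>
  An additive abelian group is rendered by the locale \<open>abelian_group\<close>; only the carrier, the
  addition and the zero of the underlying ring record are used, the multiplicative fields
  are unconstrained.
\<close>

definition signed_sumset :: "('a, 'b) ring_scheme \<Rightarrow> nat \<Rightarrow> 'a set \<Rightarrow> 'a set" where
  "signed_sumset G h A =
     {\<Oplus>\<^bsub>G\<^esub>a\<in>A. [l a] \<cdot>\<^bsub>G\<^esub> a | l :: 'a \<Rightarrow> int.
        (\<forall>a\<in>A. l a \<in> {- int h..int h}) \<and> (\<Sum>a\<in>A. \<bar>l a\<bar>) = int h}"

definition signed_sumset_on :: "('a, 'b) ring_scheme \<Rightarrow> nat set \<Rightarrow> 'a set \<Rightarrow> 'a set" where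
  "signed_sumset_on G H A = (\<Union>h\<in>H. signed_sumset G h A)"

definition admissible_sets :: "('a, 'b) ring_scheme \<Rightarrow> nat \<Rightarrow> nat \<Rightarrow> 'a set set" where
  "admissible_sets G m s =
     {A. A \<subseteq> carrier G \<and> finite A \<and> A \<noteq> {} \<and> card A = m \<and> card (A \<inter> a_inv G ` A) = s}"

text \<open>
  The infimum is taken in \<^typ>\<open>enat\<close>: it is the minimum when some admissible set exists, and
  \<open>\<infinity>\<close> otherwise, so that no finite value is assigned to an empty family.
\<close>

definition rho_signed :: "('a, 'b) ring_scheme \<Rightarrow> nat \<Rightarrow> nat \<Rightarrow> nat set \<Rightarrow> enat" where
  "rho_signed G s m H = (INF A\<in>admissible_sets G m s. enat (card (signed_sumset_on G H A)))"

text \<open>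
  Infinite subgroups count as having order \<open>\<infinity>\<close>, and the infimum of the empty set in
  \<^typ>\<open>enat\<close> is \<open>\<infinity>\<close>; hence \<open>p(G) = \<infinity>\<close> when there is no finite nontrivial subgroup.
\<close>

definition min_subgroup_order :: "('a, 'b) ring_scheme \<Rightarrow> enat" where
  "min_subgroup_order G =
     (INF K\<in>{K. additive_subgroup K G \<and> K \<noteq> {\<zero>\<^bsub>G\<^esub>}}. if finite K then enat (card K) else \<infinity>)"

end

theory Submission
  imports Defs
begin

text \<open>
  A coefficient put on \<open>\<zero>\<close> contributes nothing to a signed sum but does use up weight.
  Hence, when \<open>\<zero> \<notin> A\<close>, the \<open>h\<close>-fold signed sumset of \<open>insert \<zero> A\<close> is the set of
  all signed sums over \<open>A\<close> of weight at most \<open>h\<close>; this is lemma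
  \<open>signed_sumset_insert_zero\<close>, and it implies that the intervals \<open>{0..h}\<close> and the
  singleton \<open>{h}\<close> give the same sumset as soon as \<open>\<zero> \<in> A\<close>.

  The hypothesis on \<open>G\<close> says that no nonzero element is its own inverse, so negation pairs off the
  nonzero elements of \<open>A \<inter> - A\<close>: this set has odd size exactly when \<open>\<zero> \<in> A\<close>
  (lemma \<open>odd_card_symmetric_part\<close>). For odd \<open>s\<close> every admissible set therefore contains
  \<open>\<zero>\<close>, and the two minimised functions agree set by set. For even \<open>s\<close> no admissible set
  contains \<open>\<zero>\<close>, and inserting \<open>\<zero>\<close> is a bijection onto the admissible sets of
  parameters \<open>m + 1\<close> and \<open>s + 1\<close>, under which \<open>{0..h}\<close>-sumsets become
  \<open>h\<close>-sumsets.
\<close>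

lemma even_card_fixpoint_free_involution:
  assumes "finite S"
    and "\<And>x. x \<in> S \<Longrightarrow> f x \<in> S" "\<And>x. x \<in> S \<Longrightarrow> f (f x) = x" "\<And>x. x \<in> S \<Longrightarrow> f x \<noteq> x"
  shows "even (card S)"
  using assms
proof (induction S rule: finite_psubset_induct)
  case (psubset S)
  show ?case
  proof (cases "S = {}")
    case False
    then obtain x where x: "x \<in> S" by blast
    let ?T = "S - {x, f x}"
    have "f y \<in> ?T" if "y \<in> ?T" for y
      using that x psubset.prems by (metis Diff_iff insert_iff empty_iff)
    moreover have "?T \<subset> S"
      using x by blast
    ultimately have "even (card ?T)"
      using psubset.IH[of ?T] psubset.prems by blast
    moreover have "card S = card ?T + card {x, f x}"
      using x psubset.prems(1) psubset.hyps card_Diff_subset[of "{x, f x}" S]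
        card_mono[of S "{x, f x}"] by simp
    moreover have "card {x, f x} = 2"
      using psubset.prems(3)[OF x] by auto
    ultimately show ?thesis
      by simp
  qed simp
qed

context abelian_group
begin

lemma a_inv_zero: "\<ominus> \<zero> = \<zero>"
  using r_neg[of \<zero>] by simp

text \<open>A nonzero self-inverse \<open>x\<close> would give the subgroup \<open>{\<zero>, x}\<close> of order two.\<close>

lemma a_inv_neq_self:
  assumes "min_subgroup_order G \<ge> 3" "x \<in> carrier G" "x \<noteq> \<zero>"
  shows "\<ominus> x \<noteq> x"
proof
  assume inv: "\<ominus> x = x"
  then have xx: "x \<oplus> x = \<zero>"
    using assms(2) r_neg by metis
  have "additive_subgroup {\<zero>, x} G"
    unfolding additive_subgroup_def
    by (rule group.subgroupI[OF a_group]) (use assms(2) inv xx in \<open>auto simp: a_inv_def[symmetric]\<close>)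
  then have "min_subgroup_order G \<le> enat (card {\<zero>, x})"
    unfolding min_subgroup_order_def using assms(3)
    by (intro INF_lower2[of "{\<zero>, x}"]) auto
  also have "\<dots> = 2"
    using assms(3) by (simp add: numeral_eq_enat)
  finally have "(3::enat) \<le> 2"
    using assms(1) order.trans by blast
  then show False
    by simp
qed

text \<open>
  Negation is an involution of the symmetric part whose only possible fixed point is \<open>\<zero>\<close>.
\<close>

lemma odd_card_symmetric_part:
  assumes "min_subgroup_order G \<ge> 3" "A \<subseteq> carrier G" "finite A"
  shows "odd (card (A \<inter> a_inv G ` A)) \<longleftrightarrow> \<zero> \<in> A"
proof -
  let ?S = "A \<inter> a_inv G ` A"
  have even: "even (card (?S - {\<zero>}))"
  proof (rule even_card_fixpoint_free_involution[where f = "a_inv G"])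
    fix x assume x: "x \<in> ?S - {\<zero>}"
    then have "x \<in> carrier G"
      using assms(2) by blast
    with x show "\<ominus> x \<noteq> x"
      using a_inv_neq_self assms(1) by blast
    show inv: "\<ominus> (\<ominus> x) = x"
      using \<open>x \<in> carrier G\<close> by simp
    have "\<ominus> x \<in> A"
      using x assms(2) minus_minus by auto
    moreover have "\<ominus> x \<noteq> \<zero>"
      using x inv a_inv_zero by force
    ultimately show "\<ominus> x \<in> ?S - {\<zero>}"
      using x by blast
  qed (use assms(3) in simp)
  have zero_iff: "\<zero> \<in> ?S \<longleftrightarrow> \<zero> \<in> A"
    using imageI[of \<zero> A "a_inv G"] unfolding a_inv_zero by blast
  show ?thesis
  proof (cases "\<zero> \<in> A")
    case True
    then have "card ?S = Suc (card (?S - {\<zero>}))"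
      using zero_iff assms(3) by (intro card.remove) simp_all
    with True even show ?thesis
      by simp
  next
    case False
    then have "?S - {\<zero>} = ?S"
      by blast
    with False even show ?thesis
      by simp
  qed
qed

text \<open>The bound on the single coefficients follows from the value of the total weight.\<close>

lemma signed_sumset_eq:
  assumes "finite A"
  shows "signed_sumset G h A =
    {\<Oplus>a\<in>A. [l a] \<cdot> a | l :: 'a \<Rightarrow> int. (\<Sum>a\<in>A. \<bar>l a\<bar>) = int h}"
proof -
  have "l a \<in> {- int h..int h}" if "(\<Sum>a\<in>A. \<bar>l a\<bar>) = int h" "a \<in> A" for l :: "'a \<Rightarrow> int" and a
    using member_le_sum[of a A "\<lambda>a. \<bar>l a\<bar>"] that assms by auto
  then show ?thesis
    unfolding signed_sumset_def by blast
qed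

lemma finsum_insert_zero:
  fixes l :: "'a \<Rightarrow> int"
  assumes "finite A" "A \<subseteq> carrier G" "\<zero> \<notin> A"
  shows "(\<Oplus>a\<in>insert \<zero> A. [l a] \<cdot> a) = (\<Oplus>a\<in>A. [l a] \<cdot> a)"
proof -
  have cl: "(\<lambda>a. [l a] \<cdot> a) \<in> A \<rightarrow> carrier G"
    using assms(2) add.int_pow_closed by blast
  have z: "[l \<zero>] \<cdot> \<zero> = \<zero>"
    by (rule add.int_pow_one)
  show ?thesis
    using assms cl z by (simp add: finsum_insert)
qed

text \<open>The weight on \<open>\<zero>\<close> fills the gap between the weight on \<open>A\<close> and \<open>h\<close>.\<close>

lemma signed_sumset_insert_zero:
  assumes "finite A" "A \<subseteq> carrier G" "\<zero> \<notin> A"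
  shows "signed_sumset G h (insert \<zero> A) = signed_sumset_on G {0..h} A"
proof (intro subset_antisym subsetI)
  fix x assume "x \<in> signed_sumset G h (insert \<zero> A)"
  then obtain l :: "'a \<Rightarrow> int" where
    x: "x = (\<Oplus>a\<in>insert \<zero> A. [l a] \<cdot> a)" and w: "(\<Sum>a\<in>insert \<zero> A. \<bar>l a\<bar>) = int h"
    using assms(1) by (auto simp: signed_sumset_eq)
  define j where "j = nat (\<Sum>a\<in>A. \<bar>l a\<bar>)"
  have j: "(\<Sum>a\<in>A. \<bar>l a\<bar>) = int j"
    by (simp add: j_def sum_nonneg)
  have "j \<le> h"
    using w j assms by simp
  moreover have "x \<in> signed_sumset G j A"
    using x j assms by (auto simp: signed_sumset_eq finsum_insert_zero)
  ultimately show "x \<in> signed_sumset_on G {0..h} A"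
    unfolding signed_sumset_on_def by auto
next
  fix x assume "x \<in> signed_sumset_on G {0..h} A"
  then obtain j and l :: "'a \<Rightarrow> int" where
    "j \<le> h" and x: "x = (\<Oplus>a\<in>A. [l a] \<cdot> a)" and w: "(\<Sum>a\<in>A. \<bar>l a\<bar>) = int j"
    using assms(1) by (auto simp: signed_sumset_on_def signed_sumset_eq)
  define l' where "l' = l(\<zero> := int (h - j))"
  have agree: "l' a = l a" if "a \<in> A" for a
    using that assms(3) by (auto simp: l'_def)
  have "(\<Oplus>a\<in>A. [l' a] \<cdot> a) = (\<Oplus>a\<in>A. [l a] \<cdot> a)"
    by (rule finsum_cong') (use agree assms(2) in auto)
  then have "x = (\<Oplus>a\<in>insert \<zero> A. [l' a] \<cdot> a)"
    using x finsum_insert_zero[OF assms, of l'] by simp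
  moreover have "(\<Sum>a\<in>A. \<bar>l' a\<bar>) = int j"
    using w agree by simp
  then have "(\<Sum>a\<in>insert \<zero> A. \<bar>l' a\<bar>) = int h"
    using assms \<open>j \<le> h\<close> by (simp add: l'_def)
  ultimately show "x \<in> signed_sumset G h (insert \<zero> A)"
    using assms(1) signed_sumset_eq[of "insert \<zero> A"] by blast
qed

text \<open>
  Both sides are the signed sums of weight at most \<open>h\<close> over \<open>A - {\<zero>}\<close>.
\<close>

lemma signed_sumset_on_interval_zero_mem:
  assumes "finite A" "A \<subseteq> carrier G" "\<zero> \<in> A"
  shows "signed_sumset_on G {0..h} A = signed_sumset G h A"
proof -
  have eq: "signed_sumset G j A = signed_sumset_on G {0..j} (A - {\<zero>})" for j
    using signed_sumset_insert_zero[of "A - {\<zero>}" j] assms by (simp add: insert_absorb subset_iff)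
  have "(\<Union>j\<in>{0..h}. signed_sumset G j A) = (\<Union>j\<in>{0..h}. \<Union>i\<in>{0..j}. signed_sumset G i (A - {\<zero>}))"
    by (simp add: eq signed_sumset_on_def)
  also have "\<dots> = (\<Union>i\<in>{0..h}. signed_sumset G i (A - {\<zero>}))"
    by fastforce
  finally show ?thesis
    by (simp add: eq signed_sumset_on_def)
qed

text \<open>Both \<open>A\<close> and \<open>- A\<close> gain exactly the element \<open>\<zero>\<close>, so their intersection does too.\<close>

lemma card_symmetric_part_insert_zero:
  assumes "finite A" "\<zero> \<notin> A"
  shows "card (insert \<zero> A \<inter> a_inv G ` insert \<zero> A) = Suc (card (A \<inter> a_inv G ` A))"
proof -
  have "insert \<zero> A \<inter> a_inv G ` insert \<zero> A = insert \<zero> (A \<inter> a_inv G ` A)"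
    by (auto simp: a_inv_zero intro: image_eqI[of _ _ \<zero>])
  then show ?thesis
    using assms by simp
qed

lemma zero_mem_admissible_iff:
  assumes "min_subgroup_order G \<ge> 3" "A \<in> admissible_sets G m s"
  shows "\<zero> \<in> A \<longleftrightarrow> odd s"
  using odd_card_symmetric_part[of A] assms by (auto simp: admissible_sets_def)

text \<open>
  Removing \<open>\<zero>\<close> inverts the insertion, because the odd number \<open>s + 1\<close> forces \<open>\<zero>\<close>
  into every set on the left. The bound \<open>m > 0\<close> ensures that the removal leaves a nonempty set.
\<close>

lemma admissible_sets_Suc_eq_insert_zero_image:
  assumes "min_subgroup_order G \<ge> 3" "m > 0" "even s"
  shows "admissible_sets G (m + 1) (s + 1) = insert \<zero> ` admissible_sets G m s"
proof (intro subset_antisym subsetI)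
  fix B assume B: "B \<in> admissible_sets G (m + 1) (s + 1)"
  then have "\<zero> \<in> B"
    using zero_mem_admissible_iff[OF assms(1) B] assms(3) by simp
  then have ins: "B = insert \<zero> (B - {\<zero>})"
    by blast
  have fin: "finite B"
    using B by (simp add: admissible_sets_def)
  have "card (B - {\<zero>}) = m"
    using B \<open>\<zero> \<in> B\<close> fin by (simp add: admissible_sets_def)
  moreover have "B - {\<zero>} \<noteq> {}"
    using calculation assms(2) by (metis card.empty less_not_refl)
  moreover have "card ((B - {\<zero>}) \<inter> a_inv G ` (B - {\<zero>})) = s"
    using card_symmetric_part_insert_zero[of "B - {\<zero>}"] B fin
    unfolding ins[symmetric] by (simp add: admissible_sets_def)
  ultimately have "B - {\<zero>} \<in> admissible_sets G m s"
    using B fin by (auto simp: admissible_sets_def)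
  with ins show "B \<in> insert \<zero> ` admissible_sets G m s"
    by blast
next
  fix B assume "B \<in> insert \<zero> ` admissible_sets G m s"
  then obtain A where A: "A \<in> admissible_sets G m s" and B: "B = insert \<zero> A"
    by blast
  have "\<zero> \<notin> A"
    using zero_mem_admissible_iff[OF assms(1) A] assms(3) by simp
  then show "B \<in> admissible_sets G (m + 1) (s + 1)"
    using A card_symmetric_part_insert_zero[of A] unfolding B admissible_sets_def by simp
qed

lemma rho_signed_interval_odd:
  assumes "min_subgroup_order G \<ge> 3" "odd s"
  shows "rho_signed G s m {0..h} = rho_signed G s m {h}"
  unfolding rho_signed_def
proof (rule INF_cong)
  fix A assume A: "A \<in> admissible_sets G m s"
  then have "\<zero> \<in> A"
    using zero_mem_admissible_iff assms by blast
  then show "enat (card (signed_sumset_on G {0..h} A)) = enat (card (signed_sumset_on G {h} A))"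
    using signed_sumset_on_interval_zero_mem[of A h] A
    by (simp add: admissible_sets_def signed_sumset_on_def[of G "{h}"])
qed simp

lemma rho_signed_interval_even:
  assumes "min_subgroup_order G \<ge> 3" "m > 0" "even s"
  shows "rho_signed G s m {0..h} = rho_signed G (s + 1) (m + 1) {h}"
  unfolding rho_signed_def admissible_sets_Suc_eq_insert_zero_image[OF assms] image_image
proof (rule INF_cong)
  fix A assume A: "A \<in> admissible_sets G m s"
  then have "\<zero> \<notin> A"
    using zero_mem_admissible_iff assms by blast
  then show "enat (card (signed_sumset_on G {0..h} A)) =
      enat (card (signed_sumset_on G {h} (insert \<zero> A)))"
    using signed_sumset_insert_zero[of A h] A
    by (simp add: admissible_sets_def signed_sumset_on_def[of G "{h}"])
qed simp

end

theorem theorem3p3: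
  fixes G :: "('a, 'b) ring_scheme" and h m s :: nat
  assumes "abelian_group G"
    and "min_subgroup_order G \<ge> 3"
    and "h > 0" and "m > 0" and "s > 0" and "s \<le> m"
    and "admissible_sets G m s \<noteq> {}"
  shows "rho_signed G s m {0..h} =
    (if odd s then rho_signed G s m {h} else rho_signed G (s + 1) (m + 1) {h})"
  using abelian_group.rho_signed_interval_odd[OF assms(1,2)]
    abelian_group.rho_signed_interval_even[OF assms(1,2,4)]
  by simp

end
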